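(* Let $n\geq 2$. The graph $\Gamma(n,3)$ defined below is, up to isomorphism, the unique maximal strongly $(n,3)$-clique-partitioned graph.
   Context: A $v$-clique is a set of $v$ pairwise adjacent vertices. A graph of order $nv$ is weakly $(n,v)$-clique-partitioned if its vertex set can be decomposed in a unique way into $n$ vertex-disjoint $v$-cliques; it is strongly $(n,v)$-clique-partitioned if moreover the only $v$-cliques in it are the $n$ cliques of that decomposition. Every strongly $(n,v)$-clique-partitioned graph has at most $\frac{n}{2}v(v-1)+\frac{nv(n-1)(v-2)}{2}$ edges; one is called maximal if it has exactly this many edges. The graph $\Gamma(n,v)$ has vertex set $\{(i,j):0\leq i\leq n-1,\ 0\leq j\leq v-1\}$, and $(i,j)$ is adjacent to $(k,\ell)$ if and only if one of: (1) $i=k$ and $j\neq \ell$; (2) $i<k$ and $\ell-j\not\equiv 0,1 \pmod v$; (3) $i>k$ and $j-\ell\not\equiv 0,1\pmod v$. *)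

theory Defs
  imports
    "HOL-Library.Disjoint_Sets"
    "HOL-Number_Theory.Cong"
    "Graph_Theory.Pair_Digraph"
    "Graph_Theory.Digraph_Isomorphism"
begin

text \<open>
  A finite simple graph is a symmetric, loop-free, finite digraph without parallel arcs, that is, a
  \<open>pair_graph\<close>. Every undirected edge corresponds to two arcs, so edges are counted as two-element
  vertex sets rather than as arcs.
\<close>

definition uedges :: "'a pair_pre_digraph \<Rightarrow> 'a set set" where
  "uedges G = {{x, y} | x y. (x, y) \<in> parcs G}"

definition is_clique :: "'a pair_pre_digraph \<Rightarrow> nat \<Rightarrow> 'a set \<Rightarrow> bool" where
  "is_clique G v S \<longleftrightarrow>
     S \<subseteq> pverts G \<and> card S = v \<and> (\<forall>x\<in>S. \<forall>y\<in>S. x \<noteq> y \<longrightarrow> (x, y) \<in> parcs G)"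

definition clique_decomposition ::
    "'a pair_pre_digraph \<Rightarrow> nat \<Rightarrow> nat \<Rightarrow> 'a set set \<Rightarrow> bool" where
  "clique_decomposition G n v P \<longleftrightarrow>
     partition_on (pverts G) P \<and> card P = n \<and> (\<forall>S\<in>P. is_clique G v S)"

definition weakly_clique_partitioned :: "nat \<Rightarrow> nat \<Rightarrow> 'a pair_pre_digraph \<Rightarrow> bool" where
  "weakly_clique_partitioned n v G \<longleftrightarrow>
     pair_graph G \<and> card (pverts G) = n * v \<and> (\<exists>!P. clique_decomposition G n v P)"

definition strongly_clique_partitioned :: "nat \<Rightarrow> nat \<Rightarrow> 'a pair_pre_digraph \<Rightarrow> bool" where
  "strongly_clique_partitioned n v G \<longleftrightarrow>
     weakly_clique_partitioned n v G \<and>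
     (\<forall>P. clique_decomposition G n v P \<longrightarrow> (\<forall>S. is_clique G v S \<longrightarrow> S \<in> P))"

definition maximal_strongly_clique_partitioned ::
    "nat \<Rightarrow> nat \<Rightarrow> 'a pair_pre_digraph \<Rightarrow> bool" where
  "maximal_strongly_clique_partitioned n v G \<longleftrightarrow>
     strongly_clique_partitioned n v G \<and>
     real (card (uedges G)) =
       real n / 2 * real v * (real v - 1) + real n * real v * (real n - 1) * (real v - 2) / 2"

text \<open>The congruences are taken over the integers, since differences of column indices may be negative.\<close>

definition Gamma_adj :: "nat \<Rightarrow> nat \<times> nat \<Rightarrow> nat \<times> nat \<Rightarrow> bool" where
  "Gamma_adj v = (\<lambda>(i, j) (k, l).
     (i = k \<and> j \<noteq> l) \<or>
     (i < k \<and> \<not> [int l - int j = 0] (mod int v) \<and> \<not> [int l - int j = 1] (mod int v)) \<or>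
     (i > k \<and> \<not> [int j - int l = 0] (mod int v) \<and> \<not> [int j - int l = 1] (mod int v)))"

definition Gamma_graph :: "nat \<Rightarrow> nat \<Rightarrow> (nat \<times> nat) pair_pre_digraph" where
  "Gamma_graph n v =
     \<lparr> pverts = {0..<n} \<times> {0..<v},
       parcs = {(x, y). x \<in> {0..<n} \<times> {0..<v} \<and> y \<in> {0..<n} \<times> {0..<v} \<and> Gamma_adj v x y} \<rparr>"

end

theory Submission
  imports Defs
begin

text \<open>
  Outside its own triangle a vertex has at most one neighbour in each triangle, so the number of
  edges is maximal iff the edges between any two triangles form a perfect matching. Fix a triangle
  \<open>T0\<close> and colour every other triangle by transporting a labelling of \<open>T0\<close> by \<open>0, 1, 2\<close> along the
  matchings; a matching between two triangles other than \<open>T0\<close> has no fixed colour, as this would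
  close a further triangle, and so shifts colours by \<open>1\<close> or \<open>-1\<close> modulo \<open>3\<close>. Adding \<open>1\<close> to the
  colours on \<open>T0\<close> makes the same true for \<open>T0\<close>. The sign of the shift is a tournament on the
  triangles. A cyclic triple in it would have total shift \<open>3\<close> and thus produce a further
  triangle, so the tournament is a linear order, and rank and colour are the coordinates in
  \<open>\<Gamma>(n,3)\<close>.
\<close>

section \<open>Counting arcs by vertex and triangle\<close>

text \<open>The map from arcs to unordered pairs is two-to-one: symmetry supplies the reversed arc,
  and without loops it differs from the original one.\<close>

lemma card_parcs_eq_uedges:
  assumes "pair_graph G"
  shows "card (parcs G) = 2 * card (uedges G)"
proof -
  interpret pair_graph G by fact
  let ?f = "\<lambda>(x, y). {x, y}"
  have U: "uedges G = ?f ` parcs G"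
    by (force simp: uedges_def)
  have fib: "card {a \<in> parcs G. ?f a = e} = 2" if "e \<in> ?f ` parcs G" for e
  proof -
    from that obtain x y where xy: "(x, y) \<in> parcs G" "e = {x, y}" by auto
    have yx: "(y, x) \<in> parcs G" using xy(1) arcs_symmetric by blast
    have ne: "x \<noteq> y" using xy(1) pair_no_loops by fastforce
    have iff: "?f a = e \<longleftrightarrow> a = (x, y) \<or> a = (y, x)" for a
      by (cases a) (simp add: xy(2) doubleton_eq_iff)
    have "{a \<in> parcs G. ?f a = e} = {(x, y), (y, x)}"
      unfolding iff using xy(1) yx by auto
    thus ?thesis using ne by simp
  qed
  have "card (parcs G) = (\<Sum>e\<in>?f ` parcs G. card {a \<in> parcs G. ?f a = e})"
    using sum.image_gen[OF pair_finite_arcs, of "\<lambda>_. 1::nat" ?f] by simp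
  also have "\<dots> = 2 * card (uedges G)"
    using fib U by simp
  finally show ?thesis .
qed

text \<open>Every neighbourhood splits along the classes of \<open>P\<close>. With arcs counted cell
  by cell, an extremal total can be compared with a bound on each cell.\<close>

lemma card_parcs_partition:
  assumes "pair_graph G" "partition_on (pverts G) P" 
  shows "card (parcs G) = (\<Sum>(x, T)\<in>pverts G \<times> P. card {y \<in> T. (x, y) \<in> parcs G})"
proof -
  interpret pair_graph G by fact
  have finP: "finite P" using assms(2) pair_finite_verts finite_elements by blast
  have finT: "finite T" if "T \<in> P" for T
    using that assms(2) by (intro finite_subset[OF _ pair_finite_verts]) (auto simp: partition_on_def)
  have nbrs: "card {y. (x, y) \<in> parcs G} = (\<Sum>T\<in>P. card {y \<in> T. (x, y) \<in> parcs G})" for x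
  proof -
    have "{y. (x, y) \<in> parcs G} = (\<Union>T\<in>P. {y \<in> T. (x, y) \<in> parcs G})"
      using assms(2) wellformed' by (fastforce simp: partition_on_def)
    moreover have "card \<dots> = (\<Sum>T\<in>P. card {y \<in> T. (x, y) \<in> parcs G})"
      using finP finT assms(2)
      by (intro card_UN_disjoint) (auto simp: partition_on_def dest: disjointD)
    ultimately show ?thesis by simp
  qed
  have "parcs G = (SIGMA x:pverts G. {y. (x, y) \<in> parcs G})"
    using wellformed' by auto
  moreover have "card (SIGMA x:pverts G. {y. (x, y) \<in> parcs G})
      = (\<Sum>x\<in>pverts G. card {y. (x, y) \<in> parcs G})"
    using pair_finite_verts
    by (intro card_SigmaI) (auto intro!: finite_subset[OF _ pair_finite_verts] dest: wellformed')
  ultimately have "card (parcs G) = (\<Sum>x\<in>pverts G. card {y. (x, y) \<in> parcs G})"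
    by simp
  thus ?thesis by (simp add: nbrs sum.cartesian_product)
qed

text \<open>Each vertex lies in exactly one class, so its weights add up to
  \<open>card P + 1\<close>. In the application the weights bound the number of neighbours of a
  vertex in its own triangle and in another one.\<close>

lemma sum_partition_weights:
  assumes "finite V" "partition_on V P"
  shows "(\<Sum>(x, T)\<in>V \<times> P. if x \<in> T then 2 else (1::nat)) = card V * (card P + 1)"
proof -
  have finP: "finite P" using assms finite_elements by blast
  have "(\<Sum>T\<in>P. if x \<in> T then 2 else (1::nat)) = card P + 1" if x: "x \<in> V" for x
  proof -
    obtain T0 where T0: "T0 \<in> P" "x \<in> T0"
      using x partition_onD1[OF assms(2)] by blast
    have T0_unique: "T = T0" if "T \<in> P" "x \<in> T" for T
      using that T0 assms(2) by (auto simp: partition_on_def disjoint_def)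
    have "(\<Sum>T\<in>P. if x \<in> T then 2 else (1::nat)) = (\<Sum>T\<in>P. 1 + (if T = T0 then 1 else 0))"
    proof (intro sum.cong refl)
      fix T assume "T \<in> P"
      hence "x \<in> T \<longleftrightarrow> T = T0" using T0(2) T0_unique by blast
      thus "(if x \<in> T then 2 else 1) = 1 + (if T = T0 then 1 else (0::nat))" by simp
    qed
    also have "\<dots> = (\<Sum>T\<in>P. 1) + (\<Sum>T\<in>P. if T = T0 then 1 else 0)" by (rule sum.distrib)
    also have "\<dots> = card P + 1" using finP T0(1) by simp
    finally show ?thesis .
  qed
  thus ?thesis by (simp add: sum.cartesian_product[symmetric])
qed

text \<open>For triangles the bound is 3n + 3n(n-1)/2 = 3n(n+1)/2; doubling it gives the arc count
  and avoids division in the naturals.\<close>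

lemma maximal_edge_count_3_iff:
  "real m = real n / 2 * real 3 * (real 3 - 1) + real n * real 3 * (real n - 1) * (real 3 - 2) / 2
    \<longleftrightarrow> 2 * m = n * 3 * (n + 1)"
proof -
  have "real m = real n / 2 * real 3 * (real 3 - 1) + real n * real 3 * (real n - 1) * (real 3 - 2) / 2
    \<longleftrightarrow> real (2 * m) = real (n * 3 * (n + 1))"
    by (simp add: field_simps)
  thus ?thesis by (simp only: of_nat_eq_iff)
qed

section \<open>General tools: ranks in a linear order, isomorphisms from vertex maps\<close>

text \<open>The rank of \<open>x\<close> is the number of its predecessors. By transitivity these
  precede every later \<open>y\<close> too, and \<open>x\<close> itself makes the inclusion strict;
  totality then gives injectivity.\<close>

lemma ex_rank_strict_linear_order:
  assumes "finite A"
    and irrefl: "\<And>x. x \<in> A \<Longrightarrow> \<not> R x x"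
    and trans: "\<And>x y z. x \<in> A \<Longrightarrow> y \<in> A \<Longrightarrow> z \<in> A \<Longrightarrow> R x y \<Longrightarrow> R y z \<Longrightarrow> R x z"
    and total: "\<And>x y. x \<in> A \<Longrightarrow> y \<in> A \<Longrightarrow> x \<noteq> y \<Longrightarrow> R x y \<or> R y x"
  shows "\<exists>r. bij_betw r A {0..<card A} \<and> (\<forall>x\<in>A. \<forall>y\<in>A. R x y \<longrightarrow> r x < (r y :: nat))"
proof (intro exI conjI ballI impI)
  let ?r = "\<lambda>x. card {y \<in> A. R y x}"
  show less: "?r x < ?r y" if "x \<in> A" "y \<in> A" "R x y" for x y
  proof (rule psubset_card_mono)
    have "{z \<in> A. R z x} \<subseteq> {z \<in> A. R z y}" using trans that by blast
    moreover have "x \<in> {z \<in> A. R z y}" "x \<notin> {z \<in> A. R z x}" using that irrefl by blast+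
    ultimately show "{z \<in> A. R z x} \<subset> {z \<in> A. R z y}" by blast
  qed (simp add: assms(1))
  have "inj_on ?r A"
  proof (rule inj_onI, rule ccontr)
    fix x y assume xy: "x \<in> A" "y \<in> A" "?r x = ?r y" "x \<noteq> y"
    thus False using less[of x y] less[of y x] total[of x y] by auto
  qed
  moreover have "?r ` A \<subseteq> {0..<card A}"
  proof (intro image_subsetI)
    fix x assume "x \<in> A"
    hence "{y \<in> A. R y x} \<subset> A" using irrefl by blast
    thus "?r x \<in> {0..<card A}" using psubset_card_mono[OF assms(1)] by simp
  qed
  ultimately show "bij_betw ?r A {0..<card A}"
    using assms(1) by (simp add: bij_betw_def card_image card_subset_eq)
qed

text \<open>Arcs of a pair digraph are pairs of vertices, so a vertex bijection that preserves and
  reflects adjacency determines the arc map \<open>map_prod f f\<close>.\<close>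

lemma digraph_iso_with_projI:
  assumes "pair_wf_digraph G"
    and bij: "bij_betw f (pverts G) (pverts H)"
    and H: "parcs H \<subseteq> pverts H \<times> pverts H"
    and arcs: "\<And>x y. x \<in> pverts G \<Longrightarrow> y \<in> pverts G \<Longrightarrow> (f x, f y) \<in> parcs H \<longleftrightarrow> (x, y) \<in> parcs G"
  shows "digraph_iso (with_proj G) (with_proj H)"
proof -
  interpret pair_wf_digraph G by fact
  let ?h = "\<lparr>iso_verts = f, iso_arcs = map_prod f f, iso_head = snd, iso_tail = fst\<rparr>"
  have "inj_on f (pverts G)" using bij by (simp add: bij_betw_def)
  hence "inj_on (map_prod f f) (parcs G)"
    using wellformed' by (intro inj_on_subset[OF map_prod_inj_on]) auto
  hence iso: "digraph_isomorphism ?h"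
    using \<open>inj_on f (pverts G)\<close> by (auto simp: digraph_isomorphism_def wf_digraph_axioms)
  have "parcs H = map_prod f f ` parcs G"
  proof (intro equalityI subrelI)
    fix u v assume uv: "(u, v) \<in> parcs H"
    then obtain x y where "x \<in> pverts G" "y \<in> pverts G" "u = f x" "v = f y"
      using H bij_betw_imp_surj_on[OF bij] by blast
    thus "(u, v) \<in> map_prod f f ` parcs G" using uv arcs by force
  qed (use arcs wellformed' in auto)
  hence "with_proj H = app_iso ?h (with_proj G)"
    using bij by (simp add: with_proj_def app_iso_def bij_betw_def)
  thus ?thesis using iso unfolding digraph_iso_def by blast
qed

section \<open>Maximality of \<open>Gamma_graph n 3\<close>\<close>

definition Gamma_rows :: "nat \<Rightarrow> nat \<Rightarrow> (nat \<times> nat) set set" where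
  "Gamma_rows n v = (\<lambda>i. {i} \<times> {0..<v}) ` {0..<n}"

text \<open>Modulo 3, excluding the residues 0 and 1 leaves only 2, that is -1: between different
  rows, the vertex in the lower-numbered row has the column one higher.\<close>

lemma Gamma_adj_3:
  assumes "j < 3" "l < 3"
  shows "Gamma_adj 3 (i, j) (k, l) \<longleftrightarrow>
    i = k \<and> j \<noteq> l \<or> i < k \<and> j = (l + 1) mod 3 \<or> k < i \<and> l = (j + 1) mod 3"
proof -
  have "j = 0 \<or> j = 1 \<or> j = 2" "l = 0 \<or> l = 1 \<or> l = 2" using assms by auto
  thus ?thesis by (elim disjE) (simp_all add: Gamma_adj_def cong_def)
qed

lemma Gamma_adj_commute: "Gamma_adj v x y \<longleftrightarrow> Gamma_adj v y x"
  by (cases x; cases y) (auto simp only: Gamma_adj_def prod.case)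

lemma Gamma_adj_irrefl: "\<not> Gamma_adj v x x"
  by (cases x) (simp add: Gamma_adj_def)

lemma pair_graph_Gamma: "pair_graph (Gamma_graph n v)"
proof
  show "finite (pverts (Gamma_graph n v))" by (simp add: Gamma_graph_def)
  show "finite (parcs (Gamma_graph n v))"
    by (rule finite_subset[of _ "({0..<n} \<times> {0..<v}) \<times> ({0..<n} \<times> {0..<v})"])
       (auto simp: Gamma_graph_def)
  show "symmetric (with_proj (Gamma_graph n v))"
    unfolding symmetric_def with_proj_simps
    by (rule symI) (simp add: Gamma_graph_def Gamma_adj_commute)
next
  fix e assume "e \<in> parcs (Gamma_graph n v)"
  then obtain x y where "e = (x, y)" "x \<in> pverts (Gamma_graph n v)" "y \<in> pverts (Gamma_graph n v)"
    "Gamma_adj v x y"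
    by (cases e) (simp add: Gamma_graph_def)
  thus "fst e \<in> pverts (Gamma_graph n v)" "snd e \<in> pverts (Gamma_graph n v)" "fst e \<noteq> snd e"
    using Gamma_adj_irrefl by (simp, simp, metis fst_conv snd_conv)
qed

lemma partition_on_Gamma_rows:
  assumes "v > 0"
  shows "partition_on (pverts (Gamma_graph n v)) (Gamma_rows n v)"
  unfolding partition_on_def
proof (intro conjI)
  show "\<Union> (Gamma_rows n v) = pverts (Gamma_graph n v)"
    unfolding Gamma_graph_def Gamma_rows_def by auto
  show "disjoint (Gamma_rows n v)"
    unfolding Gamma_rows_def disjoint_def by blast
  have "{i} \<times> {0..<v} \<noteq> {}" for i :: nat
    using assms by simp
  thus "{} \<notin> Gamma_rows n v"
    unfolding Gamma_rows_def by blast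
qed

lemma card_Gamma_rows: "v > 0 \<Longrightarrow> card (Gamma_rows n v) = n"
proof -
  assume "v > 0"
  hence "inj_on (\<lambda>i. {i} \<times> {0..<v}) {0..<n}"
    by (intro inj_onI) (metis Sigma_empty_iff atLeastLessThan_empty_iff fst_image_times insert_not_empty
        linorder_not_less singleton_inject)
  thus ?thesis by (simp add: Gamma_rows_def card_image)
qed

lemma is_clique_Gamma_row: "S \<in> Gamma_rows n v \<Longrightarrow> is_clique (Gamma_graph n v) v S"
proof -
  assume "S \<in> Gamma_rows n v"
  then obtain i where i: "S = {i} \<times> {0..<v}" "i < n" by (auto simp: Gamma_rows_def)
  have "Gamma_adj v (i, j) (i, l)" if "j \<noteq> l" for j l
    using that by (simp add: Gamma_adj_def)
  thus ?thesis using i by (auto simp: is_clique_def Gamma_graph_def)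
qed

text \<open>A vertex has only one neighbour in any other row, so a triangle cannot have exactly two
  vertices in a row. Over three rows the column would fall by 1 twice from the first to the last,
  but adjacency of these two asks for a single fall by 1.\<close>

lemma Gamma_3_clique_in_rows:
  assumes "is_clique (Gamma_graph n 3) 3 S"
  shows "S \<in> Gamma_rows n 3"
proof -
  from assms have S: "S \<subseteq> {0..<n} \<times> {0..<3}" "card S = 3"
    and adj: "\<And>x y. x \<in> S \<Longrightarrow> y \<in> S \<Longrightarrow> x \<noteq> y \<Longrightarrow> Gamma_adj 3 x y"
    by (auto simp: is_clique_def Gamma_graph_def)
  from S(2) obtain x y z where xyz: "S = {x, y, z}" "x \<noteq> y" "y \<noteq> z" "x \<noteq> z"
    by (auto simp: card_3_iff)
  obtain i1 j1 i2 j2 i3 j3 where e: "x = (i1, j1)" "y = (i2, j2)" "z = (i3, j3)"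
    by (metis surj_pair)
  have b: "j1 < 3" "j2 < 3" "j3 < 3" using S(1) xyz(1) e by auto
  have a: "Gamma_adj 3 (i1, j1) (i2, j2)" "Gamma_adj 3 (i2, j2) (i3, j3)" "Gamma_adj 3 (i1, j1) (i3, j3)"
    using adj xyz e by auto
  have cs: "j1 = 0 \<or> j1 = 1 \<or> j1 = 2" "j2 = 0 \<or> j2 = 1 \<or> j2 = 2" "j3 = 0 \<or> j3 = 1 \<or> j3 = 2"
    using b by auto
  have not_3_dvd_2: "\<not> 3 dvd Suc (Suc 0)" by presburger
  have "i1 = i2 \<and> i2 = i3"
    using a cs unfolding Gamma_adj_3[OF b(1) b(2)] Gamma_adj_3[OF b(2) b(3)] Gamma_adj_3[OF b(1) b(3)]
    by (cases i1 i2 rule: linorder_cases; cases i2 i3 rule: linorder_cases;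
        cases i1 i3 rule: linorder_cases; auto simp: not_3_dvd_2)
  hence sub: "S \<subseteq> {i1} \<times> {0..<3}" using S(1) xyz(1) e by auto
  have "S = {i1} \<times> {0..<3}"
    by (rule card_subset_eq[OF _ sub]) (simp_all add: S(2))
  thus ?thesis using S(1) xyz(1) e by (auto simp: Gamma_rows_def)
qed

text \<open>There are no triangles besides the rows, and a decomposition has as many members as
  there are rows.\<close>

lemma clique_decomposition_Gamma_3_iff:
  "clique_decomposition (Gamma_graph n 3) n 3 P \<longleftrightarrow> P = Gamma_rows n 3"
proof
  assume P: "clique_decomposition (Gamma_graph n 3) n 3 P"
  hence sub: "P \<subseteq> Gamma_rows n 3"
    using Gamma_3_clique_in_rows by (auto simp: clique_decomposition_def)
  show "P = Gamma_rows n 3"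
    by (rule card_subset_eq[OF _ sub])
       (use P in \<open>simp_all add: clique_decomposition_def card_Gamma_rows, simp add: Gamma_rows_def\<close>)
next
  assume "P = Gamma_rows n 3"
  thus "clique_decomposition (Gamma_graph n 3) n 3 P"
    by (simp add: clique_decomposition_def partition_on_Gamma_rows card_Gamma_rows is_clique_Gamma_row)
qed

text \<open>The weights in the arc count are attained in every cell, which makes the number of edges
  maximal.\<close>

lemma card_Gamma_3_neighbours_in_row:
  assumes "x \<in> pverts (Gamma_graph n 3)" "T \<in> Gamma_rows n 3"
  shows "card {y \<in> T. (x, y) \<in> parcs (Gamma_graph n 3)} = (if x \<in> T then 2 else 1)"
proof -
  obtain i j where x: "x = (i, j)" "i < n" "j < 3"
    using assms(1) by (auto simp: Gamma_graph_def)
  obtain k where T: "T = {k} \<times> {0..<3}" "k < n"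
    using assms(2) by (auto simp: Gamma_rows_def)
  have eq: "{y \<in> T. (x, y) \<in> parcs (Gamma_graph n 3)} = {k} \<times> {l\<in>{0..<3}. Gamma_adj 3 (i, j) (k, l)}"
    using x T by (auto simp: Gamma_graph_def)
  \<comment> \<open>Solving \<open>j = (l + 1) mod 3\<close> for \<open>l\<close> gives j - 1,
    written as \<open>j + 2\<close> to stay in the naturals.\<close>
  have "{l\<in>{0..<3}. Gamma_adj 3 (i, j) (k, l)} =
      (if i = k then {0, 1, 2} - {j} else if i < k then {(j + 2) mod 3} else {(j + 1) mod 3})"
  proof (rule set_eqI)
    fix l :: nat
    have j: "j = 0 \<or> j = 1 \<or> j = 2" using x by auto
    show "l \<in> {l\<in>{0..<3}. Gamma_adj 3 (i, j) (k, l)} \<longleftrightarrow> l \<in> (if i = k then {0, 1, 2} - {j}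
        else if i < k then {(j + 2) mod 3} else {(j + 1) mod 3})"
    proof (cases "l < 3")
      case True
      hence "l = 0 \<or> l = 1 \<or> l = 2" by auto
      thus ?thesis using j by (elim disjE) (simp_all add: Gamma_adj_3)
    next
      case False
      thus ?thesis using j by (elim disjE) simp_all
    qed
  qed
  moreover have "card ({0, 1, 2} - {j}) = 2"
  proof -
    have "j \<in> {0, 1, 2}" using x by auto
    thus ?thesis by (subst card_Diff_singleton) simp_all
  qed
  ultimately show ?thesis unfolding eq using x T by (simp add: card_cartesian_product)
qed

lemma maximal_strongly_clique_partitioned_Gamma_3:
  "maximal_strongly_clique_partitioned n 3 (Gamma_graph n 3)"
proof -
  let ?G = "Gamma_graph n 3"
  have V: "card (pverts ?G) = n * 3" "finite (pverts ?G)" by (simp_all add: Gamma_graph_def)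
  have part: "partition_on (pverts ?G) (Gamma_rows n 3)" by (simp add: partition_on_Gamma_rows)
  have "card (parcs ?G) = (\<Sum>(x, T)\<in>pverts ?G \<times> Gamma_rows n 3. if x \<in> T then 2 else 1)"
    unfolding card_parcs_partition[OF pair_graph_Gamma part]
    by (intro sum.cong) (auto simp: card_Gamma_3_neighbours_in_row)
  hence "2 * card (uedges ?G) = n * 3 * (n + 1)"
    using sum_partition_weights[OF V(2) part] card_parcs_eq_uedges[OF pair_graph_Gamma, of n 3]
    by (simp add: V card_Gamma_rows)
  thus ?thesis
    unfolding maximal_strongly_clique_partitioned_def maximal_edge_count_3_iff
    by (auto simp: strongly_clique_partitioned_def weakly_clique_partitioned_def
        clique_decomposition_Gamma_3_iff pair_graph_Gamma V Gamma_3_clique_in_rows)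
qed

section \<open>From maximality to perfect matchings\<close>

text \<open>What remains of maximality once the counting is done. \<open>matching\<close> is stated
  from one vertex; used from both sides it makes the edges between two triangles a perfect
  matching.\<close>

locale matched_triangles = pair_graph G for G :: "'a pair_pre_digraph" +
  fixes P :: "'a set set"
  assumes part: "partition_on (pverts G) P"
    and clique: "T \<in> P \<Longrightarrow> is_clique G 3 T"
    and only_cliques: "is_clique G 3 T \<Longrightarrow> T \<in> P"
    and matching: "x \<in> pverts G \<Longrightarrow> T \<in> P \<Longrightarrow> x \<notin> T \<Longrightarrow> \<exists>!y. y \<in> T \<and> (x, y) \<in> parcs G"

text \<open>No cell exceeds its weight, yet cells and weights have the same sum. Hence every cell
  attains its weight, and weight 1 outside the own triangle is the matching condition.\<close>

lemma maximal_imp_matched_triangles: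
  assumes "maximal_strongly_clique_partitioned n 3 G"
  obtains P where "matched_triangles G P" "card P = n"
proof -
  have pg: "pair_graph G" and cardV: "card (pverts G) = n * 3"
    and ex: "\<exists>!P. clique_decomposition G n 3 P"
    and only_in: "\<forall>P. clique_decomposition G n 3 P \<longrightarrow> (\<forall>S. is_clique G 3 S \<longrightarrow> S \<in> P)"
    and cnt: "2 * card (uedges G) = n * 3 * (n + 1)"
    using assms unfolding maximal_strongly_clique_partitioned_def strongly_clique_partitioned_def
      weakly_clique_partitioned_def maximal_edge_count_3_iff by simp_all
  from ex obtain P where dec: "clique_decomposition G n 3 P" by (rule ex1E)
  have only: "S \<in> P" if "is_clique G 3 S" for S using only_in dec that by simp
  interpret pair_graph G by (fact pg)
  from dec have part: "partition_on (pverts G) P" and cardP: "card P = n"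
    and cl: "\<And>T. T \<in> P \<Longrightarrow> is_clique G 3 T"
    by (auto simp: clique_decomposition_def)
  have finP: "finite P" using part pair_finite_verts finite_elements by blast
  let ?N = "\<lambda>(x, T). card {y \<in> T. (x, y) \<in> parcs G}"
  let ?w = "\<lambda>(x, T). if x \<in> T then 2 else (1::nat)"
  have finT: "finite T" "card T = 3" if "T \<in> P" for T
    using cl[OF that] by (auto simp: is_clique_def intro: card_ge_0_finite)
  have le: "?N a \<le> ?w a" if a_in: "a \<in> pverts G \<times> P" for a
  proof -
    obtain x T where a: "a = (x, T)" "x \<in> pverts G" "T \<in> P" using a_in by auto
    show ?thesis
    proof (cases "x \<in> T")
      case True
      have "card {y \<in> T. (x, y) \<in> parcs G} \<le> card (T - {x})"
        using finT[OF a(3)] pair_no_loops by (intro card_mono) fastforce+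
      thus ?thesis using True finT[OF a(3)] a by simp
    next
      case False
      \<comment> \<open>Two neighbours of \<open>x\<close> in \<open>T\<close> would form with
        \<open>x\<close> a triangle that meets \<open>T\<close> without being equal to it.\<close>
      have "y = z" if yz: "y \<in> T" "z \<in> T" "(x, y) \<in> parcs G" "(x, z) \<in> parcs G" for y z
      proof (rule ccontr)
        assume "y \<noteq> z"
        hence "is_clique G 3 {x, y, z}"
          using yz False cl[OF a(3)] a arcs_symmetric
          by (auto simp: is_clique_def card_insert_if)
        hence "{x, y, z} \<in> P" by (rule only)
        hence "{x, y, z} = T" using disjointD[OF partition_onD2[OF part] _ a(3)] yz by blast
        thus False using False by auto
      qed
      hence "card {y \<in> T. (x, y) \<in> parcs G} \<le> Suc 0"
        using finT[OF a(3)] by (subst card_le_Suc0_iff_eq) auto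
      thus ?thesis using False a by simp
    qed
  qed
  \<comment> \<open>Both sums equal 3n(n+1): the first counts the arcs, the second is the total
    weight.\<close>
  have "sum ?N (pverts G \<times> P) = sum ?w (pverts G \<times> P)"
    using card_parcs_partition[OF pg part] sum_partition_weights[OF pair_finite_verts part]
      card_parcs_eq_uedges[OF pg] cnt cardV cardP by simp
  hence eq: "?N a = ?w a" if "a \<in> pverts G \<times> P" for a
    using sum_mono_inv[of ?N "pverts G \<times> P" ?w a] le that finP pair_finite_verts by blast
  have "matched_triangles G P"
  proof
    fix x T assume x: "x \<in> pverts G" "T \<in> P" "x \<notin> T"
    hence "card {y \<in> T. (x, y) \<in> parcs G} = 1" using eq[of "(x, T)"] by auto
    then obtain z where "{y \<in> T. (x, y) \<in> parcs G} = {z}" by (rule card_1_singletonE)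
    hence "y \<in> T \<and> (x, y) \<in> parcs G \<longleftrightarrow> y = z" for y by blast
    thus "\<exists>!y. y \<in> T \<and> (x, y) \<in> parcs G" by simp
  qed (use part cl only in auto)
  thus ?thesis using cardP that by blast
qed

section \<open>Colouring the triangles\<close>

context matched_triangles
begin

lemma in_verts: "T \<in> P \<Longrightarrow> x \<in> T \<Longrightarrow> x \<in> pverts G"
  using part by (auto simp: partition_on_def)

lemma class_eq: "S \<in> P \<Longrightarrow> T \<in> P \<Longrightarrow> x \<in> S \<Longrightarrow> x \<in> T \<Longrightarrow> S = T"
  using part by (auto simp: partition_on_def disjoint_def)

lemma finite_class: "T \<in> P \<Longrightarrow> finite T" and card_class: "T \<in> P \<Longrightarrow> card T = 3"
  using clique by (auto simp: is_clique_def intro: card_ge_0_finite)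

lemma adj_in_class: "T \<in> P \<Longrightarrow> x \<in> T \<Longrightarrow> y \<in> T \<Longrightarrow> x \<noteq> y \<Longrightarrow> (x, y) \<in> parcs G"
  using clique by (auto simp: is_clique_def)

lemma adj_commute: "(x, y) \<in> parcs G \<longleftrightarrow> (y, x) \<in> parcs G"
  using arcs_symmetric by blast

text \<open>A triangle belongs to \<open>P\<close>, and sharing \<open>x\<close> with
  \<open>T\<close> it must be \<open>T\<close>. This is how the absence of further triangles is used
  below.\<close>

lemma triangle_in_class:
  assumes "(x, y) \<in> parcs G" "(y, z) \<in> parcs G" "(x, z) \<in> parcs G" "T \<in> P" "x \<in> T"
  shows "y \<in> T"
proof -
  have "x \<noteq> y" "y \<noteq> z" "x \<noteq> z" using assms pair_no_loops by fastforce+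
  hence "is_clique G 3 {x, y, z}"
    using assms in_verts wellformed' by (auto simp: is_clique_def adj_commute card_insert_if)
  hence "{x, y, z} \<in> P" by (rule only_cliques)
  thus ?thesis using class_eq[of "{x, y, z}" T x] assms by auto
qed

text \<open>Two alternatives suffice because a permutation of three colours without fixed point is
  one of the two 3-cycles. Between triangles other than \<open>T0\<close> the matching induces such
  a permutation; for \<open>T0\<close> the shift is built into the colouring.\<close>

lemma ex_colouring:
  assumes "T0 \<in> P"
  obtains c :: "'a \<Rightarrow> nat" where "\<And>T. T \<in> P \<Longrightarrow> bij_betw c T {0..<3}"
    and "\<And>S T. S \<in> P \<Longrightarrow> T \<in> P \<Longrightarrow> S \<noteq> T \<Longrightarrow>
      (\<forall>x\<in>S. \<forall>y\<in>T. (x, y) \<in> parcs G \<longleftrightarrow> c x = (c y + 1) mod 3) \<or>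
      (\<forall>x\<in>S. \<forall>y\<in>T. (x, y) \<in> parcs G \<longleftrightarrow> c y = (c x + 1) mod 3)"
proof -
  obtain c0 where c0: "bij_betw c0 T0 {0..<3::nat}"
    using ex_bij_betw_finite_nat[OF finite_class[OF assms]] card_class[OF assms] by auto
  define m where "m x = (THE y. y \<in> T0 \<and> (x, y) \<in> parcs G)" for x
  have m: "m x \<in> T0" "(x, m x) \<in> parcs G"
    and m_unique: "\<And>y. y \<in> T0 \<Longrightarrow> (x, y) \<in> parcs G \<Longrightarrow> y = m x"
    if "T \<in> P" "T \<noteq> T0" "x \<in> T" for T x
  proof -
    have "x \<notin> T0" using that assms class_eq by blast
    hence ex: "\<exists>!y. y \<in> T0 \<and> (x, y) \<in> parcs G"
      using matching in_verts that assms by blast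
    show "m x \<in> T0" "(x, m x) \<in> parcs G" using theI'[OF ex] by (auto simp: m_def)
    thus "\<And>y. y \<in> T0 \<Longrightarrow> (x, y) \<in> parcs G \<Longrightarrow> y = m x" using ex by blast
  qed
  \<comment> \<open>Adjacent vertices with a common partner in \<open>T0\<close> would close a
    triangle through \<open>T0\<close>. The case \<open>S = T\<close> is included: it yields
    injectivity of the colouring on a triangle.\<close>
  have m_ne: "m x \<noteq> m y"
    if "S \<in> P" "S \<noteq> T0" "x \<in> S" "T \<in> P" "T \<noteq> T0" "y \<in> T" "(x, y) \<in> parcs G" for S T x y
  proof
    assume eq: "m x = m y"
    have "x \<in> T0"
      by (rule triangle_in_class[of "m x" x y])
         (use m[OF that(1-3)] m[OF that(4-6)] that eq assms in \<open>auto simp: adj_commute\<close>)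
    thus False using that assms class_eq by blast
  qed
  \<comment> \<open>Without the shift on \<open>T0\<close>, the matchings to \<open>T0\<close> would preserve colours instead of shifting them.\<close>
  define c where "c x = (if x \<in> T0 then (c0 x + 1) mod 3 else c0 (m x))" for x
  have c_other: "c x = c0 (m x)" if "T \<in> P" "T \<noteq> T0" "x \<in> T" for T x
    using that assms class_eq by (auto simp: c_def)
  have c0_lt: "c0 x < 3" if "x \<in> T0" for x using bij_betw_apply[OF c0 that] by simp
  have c0_eq: "c0 x = c0 y \<longleftrightarrow> x = y" if "x \<in> T0" "y \<in> T0" for x y
    using c0 that by (auto simp: bij_betw_def inj_on_def)
  have shift_inj: "Suc a mod 3 = Suc b mod 3 \<longleftrightarrow> a = b" if "a < 3" "b < 3" for a b :: nat
  proof -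
    have "a = 0 \<or> a = 1 \<or> a = 2" "b = 0 \<or> b = 1 \<or> b = 2" using that by auto
    thus ?thesis by auto
  qed
  have bij: "bij_betw c T {0..<3}" if T: "T \<in> P" for T
  proof -
    have "inj_on c T"
    proof (cases "T = T0")
      case True
      thus ?thesis by (auto simp: inj_on_def c_def shift_inj c0_lt c0_eq)
    next
      case False
      show ?thesis
      proof (rule inj_onI, rule ccontr)
        fix x y assume xy: "x \<in> T" "y \<in> T" "c x = c y" "x \<noteq> y"
        have "m x = m y" using xy c_other[OF T False] m(1)[OF T False] c0_eq by metis
        thus False using m_ne[OF T False xy(1) T False xy(2)] adj_in_class[OF T xy(1,2,4)] by blast
      qed
    qed
    moreover have "c ` T \<subseteq> {0..<3}"
      using c0_lt m(1)[OF T] c_other[OF T] by (cases "T = T0") (auto simp: c_def)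
    ultimately show ?thesis
      using card_class[OF T] by (simp add: bij_betw_def card_image card_subset_eq)
  qed
  \<comment> \<open>Adding 1 on \<open>T0\<close> turns equality of transported labels into a
    difference of 1, always in the same direction.\<close>
  have base: "(x, y) \<in> parcs G \<longleftrightarrow> c x = (c y + 1) mod 3"
    if "x \<in> T0" "T \<in> P" "T \<noteq> T0" "y \<in> T" for x y T
  proof -
    have "(x, y) \<in> parcs G \<longleftrightarrow> x = m y"
      using m_unique[OF that(2-4)] m[OF that(2-4)] that(1) adj_commute by blast
    thus ?thesis
      using c_other[OF that(2-4)] that(1) m(1)[OF that(2-4)]
      by (simp add: c_def shift_inj c0_lt c0_eq)
  qed
  have shift: "(\<forall>x\<in>S. \<forall>y\<in>T. (x, y) \<in> parcs G \<longleftrightarrow> c x = (c y + 1) mod 3) \<or>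
      (\<forall>x\<in>S. \<forall>y\<in>T. (x, y) \<in> parcs G \<longleftrightarrow> c y = (c x + 1) mod 3)"
    if ST: "S \<in> P" "T \<in> P" "S \<noteq> T" "S \<noteq> T0" "T \<noteq> T0" for S T
  proof -
    have ex: "\<exists>x\<in>U. c x = i" if "U \<in> P" "i < 3" for U i
    proof -
      have "i \<in> c ` U" using bij_betw_imp_surj_on[OF bij[OF that(1)]] that(2) by simp
      thus ?thesis by blast
    qed
    \<comment> \<open>Naming the vertices by their colours lets the quantifiers over
      \<open>S\<close> and \<open>T\<close> unfold into nine concrete adjacencies.\<close>
    have col: "U = {a, b, d}" if "U \<in> P" "a \<in> U" "b \<in> U" "d \<in> U" "c a = 0" "c b = 1" "c d = 2" for U a b d
    proof -
      have "{a, b, d} = U"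
        using that finite_class card_class by (intro card_subset_eq) (auto simp: card_insert_if)
      thus ?thesis by simp
    qed
    obtain a0 a1 a2 where a: "a0 \<in> S" "a1 \<in> S" "a2 \<in> S" "c a0 = 0" "c a1 = 1" "c a2 = 2"
      using ex[OF ST(1), of 0] ex[OF ST(1), of 1] ex[OF ST(1), of 2] by auto
    obtain b0 b1 b2 where b: "b0 \<in> T" "b1 \<in> T" "b2 \<in> T" "c b0 = 0" "c b1 = 1" "c b2 = 2"
      using ex[OF ST(2), of 0] ex[OF ST(2), of 1] ex[OF ST(2), of 2] by auto
    note S = col[OF ST(1) a] and T = col[OF ST(2) b]
    have ne: "a0 \<noteq> a1" "a0 \<noteq> a2" "a1 \<noteq> a2" "b0 \<noteq> b1" "b0 \<noteq> b2" "b1 \<noteq> b2" using a b by auto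
    have diag: "c x \<noteq> c y" if "x \<in> S" "y \<in> T" "(x, y) \<in> parcs G" for x y
      using m_ne[OF ST(1,4) that(1) ST(2,5) that(2,3)] c_other[OF ST(1,4) that(1)]
        c_other[OF ST(2,5) that(2)] m(1)[OF ST(1,4) that(1)] m(1)[OF ST(2,5) that(2)] c0_eq by simp
    have row: "\<exists>!y. y \<in> T \<and> (x, y) \<in> parcs G" if "x \<in> S" for x
    proof -
      have "x \<notin> T" using that class_eq ST(1-3) by blast
      thus ?thesis by (rule matching[OF in_verts[OF ST(1) that] ST(2)])
    qed
    have column: "\<exists>!x. x \<in> S \<and> (x, y) \<in> parcs G" if "y \<in> T" for y
    proof -
      have "y \<notin> S" using that class_eq ST(1-3) by blast
      thus ?thesis
        unfolding adj_commute[of _ y] by (rule matching[OF in_verts[OF ST(2) that] ST(1)])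
    qed
    \<comment> \<open>Uniqueness in a three-element set with one member excluded becomes an
      exclusive or between the other two.\<close>
    have ex1_other: "Q v \<noteq> Q w"
      if "\<exists>!y. y \<in> U \<and> Q y" "U = {u, v, w}" "\<not> Q u" "v \<noteq> w" for Q and U :: "'a set" and u v w
      using that by blast
    let ?E = "\<lambda>x y. (x, y) \<in> parcs G"
    have d: "\<not> ?E a0 b0" "\<not> ?E a1 b1" "\<not> ?E a2 b2"
      using diag[OF a(1) b(1)] diag[OF a(2) b(2)] diag[OF a(3) b(3)] a(4-6) b(4-6) by auto
    have r: "?E a0 b1 \<noteq> ?E a0 b2" "?E a1 b0 \<noteq> ?E a1 b2" "?E a2 b0 \<noteq> ?E a2 b1"
      using T d ne ex1_other[OF row[OF a(1)], of b0 b1 b2] ex1_other[OF row[OF a(2)], of b1 b0 b2]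
        ex1_other[OF row[OF a(3)], of b2 b0 b1] by (simp_all add: insert_commute)
    have k: "?E a1 b0 \<noteq> ?E a2 b0" "?E a0 b1 \<noteq> ?E a2 b1" "?E a0 b2 \<noteq> ?E a1 b2"
      using S d ne ex1_other[OF column[OF b(1)], of a0 a1 a2] ex1_other[OF column[OF b(2)], of a1 a0 a2]
        ex1_other[OF column[OF b(3)], of a2 a0 a1] by (simp_all add: insert_commute)
    have mods: "(0 + 1) mod 3 = (1::nat)" "(1 + 1) mod 3 = (2::nat)" "(2 + 1) mod 3 = (0::nat)"
      by simp_all
    \<comment> \<open>The adjacency matrix of \<open>S\<close> and \<open>T\<close> is a permutation
      matrix with zero diagonal, so the entry at \<open>a0\<close>, \<open>b1\<close> decides the
      rest: if it is an edge, colours rise by 1 from \<open>S\<close> to \<open>T\<close>, otherwise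
      they fall by 1.\<close>
    show ?thesis
      unfolding S T ball_simps a(4-6) b(4-6) mods
      using d r k by (cases "?E a0 b1") simp_all
  qed
  show ?thesis
  proof (rule that[OF bij])
    fix S T assume ST: "S \<in> P" "T \<in> P" "S \<noteq> T"
    consider "S = T0" "T \<noteq> T0" | "T = T0" "S \<noteq> T0" | "S \<noteq> T0" "T \<noteq> T0" using ST by blast
    thus "(\<forall>x\<in>S. \<forall>y\<in>T. (x, y) \<in> parcs G \<longleftrightarrow> c x = (c y + 1) mod 3) \<or>
      (\<forall>x\<in>S. \<forall>y\<in>T. (x, y) \<in> parcs G \<longleftrightarrow> c y = (c x + 1) mod 3)"
    proof cases
      case 1
      have "(x, y) \<in> parcs G \<longleftrightarrow> c x = (c y + 1) mod 3" if "x \<in> S" "y \<in> T" for x y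
        using base[OF _ ST(2) 1(2) that(2), of x] that(1) 1(1) by simp
      thus ?thesis by simp
    next
      case 2
      have "(x, y) \<in> parcs G \<longleftrightarrow> c y = (c x + 1) mod 3" if "x \<in> S" "y \<in> T" for x y
        using base[OF _ ST(1) 2(2) that(1), of y] that(2) 2(1) unfolding adj_commute[of x y] by simp
      thus ?thesis by simp
    next
      case 3
      thus ?thesis by (rule shift[OF ST])
    qed
  qed
qed

section \<open>Ordering the triangles, and the isomorphism\<close>

text \<open>The rank of a triangle in the order \<open>R\<close> becomes the row and the colour
  becomes the column. Nonemptiness of \<open>P\<close> supplies the triangle from which the
  colouring starts.\<close>

lemma iso_Gamma_graph:
  assumes "P \<noteq> {}"
  shows "digraph_iso (with_proj G) (with_proj (Gamma_graph (card P) 3))"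
proof -
  obtain c :: "'a \<Rightarrow> nat" where bij: "\<And>T. T \<in> P \<Longrightarrow> bij_betw c T {0..<3}"
    and shift: "\<And>S T. S \<in> P \<Longrightarrow> T \<in> P \<Longrightarrow> S \<noteq> T \<Longrightarrow>
      (\<forall>x\<in>S. \<forall>y\<in>T. (x, y) \<in> parcs G \<longleftrightarrow> c x = (c y + 1) mod 3) \<or>
      (\<forall>x\<in>S. \<forall>y\<in>T. (x, y) \<in> parcs G \<longleftrightarrow> c y = (c x + 1) mod 3)"
    using assms ex_colouring by blast
  have finP: "finite P" using part pair_finite_verts finite_elements by blast
  have c_lt: "c x < 3" if "T \<in> P" "x \<in> T" for T x
    using bij_betw_apply[OF bij[OF that(1)] that(2)] by simp
  have c_inj: "c x = c y \<longleftrightarrow> x = y" if "T \<in> P" "x \<in> T" "y \<in> T" for T x y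
    using bij_betw_imp_inj_on[OF bij[OF that(1)]] that(2,3) by (auto dest: inj_onD)
  have c_ex: "\<exists>x\<in>T. c x = i" if "T \<in> P" "i < 3" for T i
  proof -
    have "i \<in> c ` T" using bij_betw_imp_surj_on[OF bij[OF that(1)]] that(2) by simp
    thus ?thesis by blast
  qed
  \<comment> \<open>The orientation agrees with \<open>Gamma_adj_3\<close>: along an edge, the
    earlier triangle carries the colour that is one higher modulo 3.\<close>
  define R where "R S T \<longleftrightarrow> S \<noteq> T \<and> (\<forall>x\<in>S. \<forall>y\<in>T. (x, y) \<in> parcs G \<longleftrightarrow> c x = (c y + 1) mod 3)"
    for S T
  have total: "R S T \<or> R T S" if "S \<in> P" "T \<in> P" "S \<noteq> T" for S T
    using shift[OF that]
  proof
    assume *: "\<forall>x\<in>S. \<forall>y\<in>T. (x, y) \<in> parcs G \<longleftrightarrow> c y = (c x + 1) mod 3"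
    have "(y, x) \<in> parcs G \<longleftrightarrow> c y = (c x + 1) mod 3" if "x \<in> S" "y \<in> T" for x y
      unfolding adj_commute[of y x] using * that by blast
    thus ?thesis using that(3) by (simp add: R_def)
  qed (use that(3) in \<open>simp add: R_def\<close>)
  have edge: "\<exists>x\<in>S. \<exists>y\<in>T. c x = i \<and> c y = j \<and> (x, y) \<in> parcs G"
    if ST: "R S T" "S \<in> P" "T \<in> P" "i = (j + 1) mod 3" "j < 3" for S T i j
  proof -
    obtain x where "x \<in> S" "c x = i" using c_ex[OF ST(2), of i] ST(4) by auto
    moreover obtain y where "y \<in> T" "c y = j" using c_ex[OF ST(3,5)] by blast
    ultimately show ?thesis using ST(1,4) unfolding R_def by blast
  qed
  have no_cycle: "\<not> R U S" if STU: "R S T" "R T U" "S \<in> P" "T \<in> P" "U \<in> P" for S T U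
  proof
    assume US: "R U S"
    \<comment> \<open>Colours 2, 1, 0 on \<open>S\<close>, \<open>T\<close>, \<open>U\<close> each
      exceed the next by 1, cyclically modulo 3, so these three vertices close a triangle outside
      \<open>P\<close>.\<close>
    obtain x y where xy: "x \<in> S" "y \<in> T" "c x = 2" "c y = 1" "(x, y) \<in> parcs G"
      using edge[OF STU(1,3,4), of 2 1] by auto
    obtain z where z: "z \<in> U" "c z = 0" using c_ex[OF STU(5), of 0] by auto
    have "(y, z) \<in> parcs G" "(z, x) \<in> parcs G"
      using STU(2) US xy z unfolding R_def by auto
    hence "y \<in> S" using triangle_in_class[of x y z S] xy STU(3) adj_commute by blast
    thus False using class_eq STU xy unfolding R_def by blast
  qed
  have asym: "\<not> R T S" if ST: "R S T" "S \<in> P" "T \<in> P" for S T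
  proof
    assume TS: "R T S"
    \<comment> \<open>For this edge, \<open>R T S\<close> would force the colour of \<open>y\<close>
      to be 2 instead of 0.\<close>
    obtain x y where xy: "x \<in> S" "y \<in> T" "c x = 1" "c y = 0" "(x, y) \<in> parcs G"
      using edge[OF ST, of 1 0] by auto
    thus False using TS adj_commute unfolding R_def by force
  qed
  have R_irrefl: "\<not> R S S" if "S \<in> P" for S by (simp add: R_def)
  have R_trans: "R S U" if STU: "S \<in> P" "T \<in> P" "U \<in> P" "R S T" "R T U" for S T U
  proof -
    \<comment> \<open>By \<open>total\<close>, only \<open>R U S\<close> could then prevent the
      conclusion, and it would complete a cyclic triple.\<close>
    have "S \<noteq> U" using asym[OF STU(4,1,2)] STU(5) by blast
    thus ?thesis using total[OF STU(1,3)] no_cycle[OF STU(4,5,1,2,3)] by blast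
  qed
  obtain r where r: "bij_betw r P {0..<card P}"
    and r_less: "\<And>S T. S \<in> P \<Longrightarrow> T \<in> P \<Longrightarrow> R S T \<Longrightarrow> r S < r T"
  proof -
    have "\<exists>r. bij_betw r P {0..<card P} \<and> (\<forall>S\<in>P. \<forall>T\<in>P. R S T \<longrightarrow> r S < (r T :: nat))"
      by (rule ex_rank_strict_linear_order[of P R]) (fact finP R_irrefl R_trans total)+
    thus ?thesis using that by blast
  qed
  define cls where "cls x = (THE T. T \<in> P \<and> x \<in> T)" for x
  have cls: "cls x = T" if "T \<in> P" "x \<in> T" for x T
    unfolding cls_def
  proof (rule the_equality)
    show "S = T" if "S \<in> P \<and> x \<in> S" for S
      using class_eq[of S T x] that \<open>T \<in> P\<close> \<open>x \<in> T\<close> by blast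
  qed (use that in blast)
  have ex_cls: "\<exists>T\<in>P. x \<in> T" if "x \<in> pverts G" for x
    using that unfolding partition_onD1[OF part] by blast
  let ?f = "\<lambda>x. (r (cls x), c x)"
  have bij_f: "bij_betw ?f (pverts G) (pverts (Gamma_graph (card P) 3))"
    unfolding bij_betw_def
  proof
    show "inj_on ?f (pverts G)"
    proof (rule inj_onI)
      fix x y assume xy: "x \<in> pverts G" "y \<in> pverts G" "?f x = ?f y"
      obtain S T where ST: "S \<in> P" "x \<in> S" "T \<in> P" "y \<in> T" using ex_cls xy by meson
      have "r S = r T" "c x = c y" using xy(3) cls[OF ST(1,2)] cls[OF ST(3,4)] by simp_all
      moreover have "S = T" using inj_onD[OF bij_betw_imp_inj_on[OF r] \<open>r S = r T\<close>] ST(1,3) by blast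
      ultimately show "x = y" using c_inj[OF ST(1,2), of y] ST(4) by simp
    qed
    show "?f ` pverts G = pverts (Gamma_graph (card P) 3)"
    proof (intro equalityI subsetI)
      fix p assume "p \<in> ?f ` pverts G"
      then obtain x where x: "x \<in> pverts G" "p = ?f x" by blast
      obtain T where T: "T \<in> P" "x \<in> T" using ex_cls x by blast
      show "p \<in> pverts (Gamma_graph (card P) 3)"
        using x(2) cls[OF T] c_lt[OF T] bij_betw_apply[OF r T(1)] by (simp add: Gamma_graph_def)
    next
      fix p assume "p \<in> pverts (Gamma_graph (card P) 3)"
      then obtain i j where p: "p = (i, j)" "i \<in> {0..<card P}" "j < 3" by (auto simp: Gamma_graph_def)
      obtain T where T: "T \<in> P" "i = r T"
        using p(2) bij_betw_imp_surj_on[OF r] by blast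
      obtain x where x: "x \<in> T" "c x = j" using c_ex[OF T(1) p(3)] by blast
      have "p = ?f x" using p(1) T(2) x(2) cls[OF T(1) x(1)] by simp
      thus "p \<in> ?f ` pverts G" using in_verts[OF T(1) x(1)] by blast
    qed
  qed
  show ?thesis
  proof (rule digraph_iso_with_projI[OF _ bij_f])
    show "pair_wf_digraph G" by unfold_locales
    show "parcs (Gamma_graph (card P) 3)
        \<subseteq> pverts (Gamma_graph (card P) 3) \<times> pverts (Gamma_graph (card P) 3)"
      by (auto simp: Gamma_graph_def)
    fix x y assume xy: "x \<in> pverts G" "y \<in> pverts G"
    have "?f x \<in> pverts (Gamma_graph (card P) 3)" "?f y \<in> pverts (Gamma_graph (card P) 3)"
      using bij_betw_apply[OF bij_f] xy by blast+
    hence adj: "(?f x, ?f y) \<in> parcs (Gamma_graph (card P) 3) \<longleftrightarrow> Gamma_adj 3 (?f x) (?f y)"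
      by (simp add: Gamma_graph_def)
    obtain S T where ST: "S \<in> P" "x \<in> S" "T \<in> P" "y \<in> T" using ex_cls xy by meson
    have lt: "c x < 3" "c y < 3" using c_lt[OF ST(1,2)] c_lt[OF ST(3,4)] .
    have "Gamma_adj 3 (r S, c x) (r T, c y) \<longleftrightarrow> (x, y) \<in> parcs G"
    proof (cases "S = T")
      case True
      hence adj_iff: "(x, y) \<in> parcs G \<longleftrightarrow> x \<noteq> y"
        using adj_in_class[OF ST(1,2), of y] pair_no_loops[of "(x, y)"] ST(4) by fastforce
      show ?thesis
        using True lt c_inj[OF ST(1,2), of y] adj_iff ST(4) by (simp add: Gamma_adj_3)
    next
      case False
      \<comment> \<open>Ranks increase along \<open>R\<close>, so they select the very clause of
        \<open>Gamma_adj_3\<close> that describes the matching.\<close>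
      then consider "R S T" | "R T S" using total ST by blast
      thus ?thesis
      proof cases
        case 1
        hence "(x, y) \<in> parcs G \<longleftrightarrow> c x = (c y + 1) mod 3" using ST(2,4) unfolding R_def by blast
        thus ?thesis using r_less[OF ST(1,3) 1] lt by (simp add: Gamma_adj_3)
      next
        case 2
        hence "(x, y) \<in> parcs G \<longleftrightarrow> c y = (c x + 1) mod 3"
          using ST(2,4) unfolding R_def adj_commute[of x y] by blast
        thus ?thesis using r_less[OF ST(3,1) 2] lt by (simp add: Gamma_adj_3)
      qed
    qed
    thus "(?f x, ?f y) \<in> parcs (Gamma_graph (card P) 3) \<longleftrightarrow> (x, y) \<in> parcs G"
      using adj cls[OF ST(1,2)] cls[OF ST(3,4)] by simp
  qed
qed

end

theorem theorem2p9:
  fixes n :: nat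
  assumes "n \<ge> 2"
  shows "maximal_strongly_clique_partitioned n 3 (Gamma_graph n 3) \<and>
    (\<forall>G :: 'a pair_pre_digraph. maximal_strongly_clique_partitioned n 3 G \<longrightarrow>
       digraph_iso (with_proj G) (with_proj (Gamma_graph n 3)))"
proof (intro conjI allI impI)
  show "maximal_strongly_clique_partitioned n 3 (Gamma_graph n 3)"
    by (rule maximal_strongly_clique_partitioned_Gamma_3)
  fix G :: "'a pair_pre_digraph"
  assume "maximal_strongly_clique_partitioned n 3 G"
  then obtain P where P: "matched_triangles G P" "card P = n" by (rule maximal_imp_matched_triangles)
  hence "P \<noteq> {}" using assms by auto
  thus "digraph_iso (with_proj G) (with_proj (Gamma_graph n 3))"
    using matched_triangles.iso_Gamma_graph[OF P(1)] P(2) by simp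
qed

end
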